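(* There exist, for each positive integer $N$, positive real numbers $\epsilon_1,\dots,\epsilon_N$ (depending on $N$) such that $$\epsilon_k=\frac{\pi}{N}+\frac{\alpha(k)}{N^2}+O\!\left(\frac{1}{N^3}\right),\qquad 1\le k\le N,$$ where the real numbers $\alpha(k)=\alpha_N(k)$ are bounded (uniformly in $k$ and $N$) and the $O(1/N^3)$ is uniform in $k$, and such that, with $f_k(z)=\frac{z}{1-z}+\epsilon_k^2$, the compositions $$f_N\circ f_{N-1}\circ\cdots\circ f_2\circ f_1$$ do not converge to the identity as $N\to\infty$.
   Context: Each $f_k$ is a Möbius transformation of the Riemann sphere $\mathbb{C}\cup\{\infty\}$, and the compositions are taken as Möbius transformations. Convergence to the identity means uniform convergence on every compact subset of $\mathbb{C}$. *)

theory Defs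
  imports "HOL-Analysis.Analysis"
begin

text \<open>
  The Riemann sphere is the one-point compactification of the complex plane, carried by
  \<^typ>\<open>complex option\<close> as in the library's \<open>Alexandroff_compactification\<close>:
  \<^const>\<open>None\<close> is the point at infinity.
\<close>

type_synonym riemann_sphere = "complex option"

text \<open>
  The map \<open>z \<mapsto> (a z + b) / (c z + d)\<close> on the sphere; it is a Moebius transformation
  when \<open>a d - b c \<noteq> 0\<close>.
\<close>

fun moebius ::
  "complex \<Rightarrow> complex \<Rightarrow> complex \<Rightarrow> complex \<Rightarrow> riemann_sphere \<Rightarrow> riemann_sphere" where
  "moebius a b c d None = (if c = 0 then None else Some (a / c))"
| "moebius a b c d (Some z) =
     (if c * z + d = 0 then None else Some ((a * z + b) / (c * z + d)))"

text \<open>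
  The coefficients are those of \<open>z / (1 - z) + e\<^sup>2\<close> over the common denominator \<open>1 - z\<close>;
  their determinant is 1.
\<close>

definition par_map :: "real \<Rightarrow> riemann_sphere \<Rightarrow> riemann_sphere" where
  "par_map e = moebius (1 - (of_real e)\<^sup>2) ((of_real e)\<^sup>2) (- 1) 1"

lemma par_map_Some:
  "z \<noteq> 1 \<Longrightarrow> par_map e (Some z) = Some (z / (1 - z) + (of_real e)\<^sup>2)"
  by (simp add: par_map_def field_simps)

lemma par_map_one: "par_map e (Some 1) = None"
  by (simp add: par_map_def)

lemma par_map_None: "par_map e None = Some ((of_real e)\<^sup>2 - 1)"
  by (simp add: par_map_def)

primrec comp_upto ::
  "(nat \<Rightarrow> riemann_sphere \<Rightarrow> riemann_sphere) \<Rightarrow> nat \<Rightarrow> riemann_sphere \<Rightarrow> riemann_sphere" where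
  "comp_upto f 0 = id"
| "comp_upto f (Suc n) = f (Suc n) \<circ> comp_upto f n"

text \<open>
  Uniform convergence to the identity on compact subsets of the plane, for sphere-valued maps.
  Since the limit is bounded on a compact \<open>K\<close>, convergent maps are eventually finite on all of
  \<open>K\<close>, so the Euclidean distance may be used in place of the spherical one.
\<close>

definition converges_to_identity :: "(nat \<Rightarrow> riemann_sphere \<Rightarrow> riemann_sphere) \<Rightarrow> bool" where
  "converges_to_identity F \<longleftrightarrow>
     (\<forall>K::complex set. compact K \<longrightarrow>
        (\<forall>\<^sub>F N in sequentially. \<forall>z\<in>K. F N (Some z) \<noteq> None) \<and>
        uniform_limit K (\<lambda>N z. the (F N (Some z))) (\<lambda>z. z) sequentially)"

end

theory Submission
  imports Defs
begin

text \<open>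
  Take \<open>\<epsilon>\<^sub>k = 2 sin (\<theta> / 2)\<close> for all \<open>k\<close>, where \<open>\<theta> = \<pi> / (N + 1) = \<pi> / N - \<pi> / N\<^sup>2 + O(1 / N\<^sup>3)\<close>.
  The matrix of \<open>f\<^sub>k\<close> has determinant \<open>1\<close> and trace \<open>2 cos \<theta>\<close>, so its power of exponent \<open>N + 1\<close>
  is \<open>-1\<close> and the \<open>N\<close>-fold composition is the inverse of \<open>f\<^sub>k\<close>, which tends to \<open>z / (1 + z)\<close>
  instead of \<open>z\<close>. It is enough to follow the orbit of \<open>1\<close>, which ends near \<open>1 / 2\<close>.
\<close>

lemma par_map_of_real:
  assumes "x \<noteq> 1"
  shows "par_map e (Some (of_real x)) = Some (of_real (x / (1 - x) + e\<^sup>2))"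
  using assms by (simp add: par_map_Some)

text \<open>In the coordinate \<open>q = 1 - z\<close> the map reads \<open>q\<close> to
  \<open>2 * cos t - 1 / q\<close>. Writing \<open>q\<close> as a ratio of consecutive terms of a
  sequence turns this into the linear recurrence with characteristic roots exp(it) and exp(-it),
  which sines along an arithmetic progression of step \<open>t\<close> satisfy.\<close>

lemma par_map_sin_quotient:
  assumes "sin y \<noteq> 0" "sin (y + t) \<noteq> 0"
  shows "par_map (2 * sin (t / 2)) (Some (of_real (1 - sin (y + t) / sin y))) =
         Some (of_real (1 - sin (y + 2 * t) / sin (y + t)))"
proof -
  have e: "(2 * sin (t / 2))\<^sup>2 = 2 - 2 * cos t"
    using cos_double_sin[of "t / 2"] by (simp add: power_mult_distrib)
  have s: "sin (y + 2 * t) = 2 * cos t * sin (y + t) - sin y"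
    using sin_add[of "y + t" t] sin_diff[of "y + t" t] by (simp add: algebra_simps)
  have q: "1 - sin (y + t) / sin y \<noteq> 1"
    using assms by simp
  have "(1 - sin (y + t) / sin y) / (1 - (1 - sin (y + t) / sin y)) + (2 * sin (t / 2))\<^sup>2
      = 1 - sin (y + 2 * t) / sin (y + t)"
    unfolding e s using assms by (simp add: field_simps)
  then show ?thesis
    unfolding par_map_of_real[OF q] by (rule arg_cong)
qed

text \<open>The first map sends 1 to infinity, formally the quotient sin t / sin 0. The closed form
  therefore starts after two maps, and from there each further map shifts both angles by
  \<open>t\<close>.\<close>

lemma comp_upto_orbit_1:
  assumes "\<And>j. \<lbrakk>1 \<le> j; j \<le> Suc n\<rbrakk> \<Longrightarrow> sin (real j * t) \<noteq> 0"
  shows "comp_upto (\<lambda>_. par_map (2 * sin (t / 2))) (Suc (Suc n)) (Some 1) =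
         Some (of_real (1 - sin (real (Suc (Suc n)) * t) / sin (real (Suc n) * t)))"
  using assms
proof (induction n)
  case 0
  have "sin t \<noteq> 0" using 0[of 1] by simp
  then have "1 - sin (2 * t) / sin t = (2 * sin (t / 2))\<^sup>2 - 1"
    using cos_double_sin[of "t / 2"] by (simp add: sin_double power_mult_distrib)
  moreover have "par_map e None = Some (of_real (e\<^sup>2 - 1))" for e
    by (simp add: par_map_None)
  ultimately show ?case
    by (simp add: par_map_one del: of_real_diff of_real_divide)
next
  case (Suc n)
  have "sin (real (Suc n) * t) \<noteq> 0" "sin (real (Suc n) * t + t) \<noteq> 0"
    using Suc.prems[of "Suc n"] Suc.prems[of "Suc (Suc n)"] by (simp_all add: algebra_simps)
  from par_map_sin_quotient[OF this] Suc show ?case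
    by (simp add: algebra_simps)
qed

lemma comp_upto_pi_over_Suc:
  assumes "n \<ge> 2"
  shows "comp_upto (\<lambda>_. par_map (2 * sin (pi / real (Suc n) / 2))) n (Some 1) =
         Some (of_real (1 - 1 / (2 * cos (pi / real (Suc n)))))"
proof -
  define t where "t = pi / real (Suc n)"
  obtain m where m: "n = Suc (Suc m)"
    using assms by (metis add_2_eq_Suc le_Suc_ex)
  \<comment> \<open>All these angles lie strictly between 0 and pi, so the orbit does not return to
    infinity within \<open>n\<close> maps.\<close>
  have pos: "sin (real j * t) > 0" if "1 \<le> j" "j \<le> n" for j
  proof (rule sin_gt_zero)
    show "0 < real j * t"
      using that by (simp add: t_def)
    have "real j * t < real (Suc n) * t"
      using that by (intro mult_strict_right_mono) (simp_all add: t_def)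
    then show "real j * t < pi"
      by (simp add: t_def)
  qed
  \<comment> \<open>Since \<open>(n + 1) * t = pi\<close>, reflection at pi turns the last quotient
    into sin t / sin 2t.\<close>
  have "sin (real n * t) = sin (pi - t)" "sin (real (Suc m) * t) = sin (pi - 2 * t)"
    by (rule arg_cong[where f = sin], simp add: t_def m field_simps)+
  moreover have "sin t > 0" using pos[of 1] assms by simp
  ultimately have "sin (real n * t) / sin (real (Suc m) * t) = 1 / (2 * cos t)"
    by (simp add: sin_double)
  moreover have "comp_upto (\<lambda>_. par_map (2 * sin (t / 2))) n (Some 1) =
      Some (of_real (1 - sin (real n * t) / sin (real (Suc m) * t)))"
    unfolding m by (rule comp_upto_orbit_1) (metis pos less_irrefl m le_SucI)
  ultimately show ?thesis
    unfolding t_def by simp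
qed

lemma two_sin_half_pi_over_Suc:
  assumes "n \<ge> 1"
  shows "\<bar>2 * sin (pi / real (Suc n) / 2) - (pi / real n + - pi / (real n)\<^sup>2)\<bar>
       \<le> (pi ^ 3 + pi) / real n ^ 3"
proof -
  define t where "t = pi / real (Suc n)"
  have n: "real n > 0" using assms by simp
  have "0 \<le> t" "t \<le> pi / real n"
    using n by (simp_all add: t_def field_simps)
  then have t3: "t ^ 3 \<le> pi ^ 3 / real n ^ 3"
    by (metis power_divide power_mono)
  \<comment> \<open>Of the Taylor terms below order 3 only the linear one survives; the remainder is
    at most (t/2)^3 / 3!.\<close>
  have "\<bar>sin (t / 2) - t / 2\<bar> \<le> t ^ 3 / 48"
    using Maclaurin_sin_bound[of "t / 2" 3] \<open>0 \<le> t\<close>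
    by (simp add: sin_coeff_def numeral_eq_Suc field_simps)
  then have "\<bar>2 * sin (t / 2) - t\<bar> \<le> t ^ 3"
    using zero_le_power[OF \<open>0 \<le> t\<close>, of 3] by linarith
  moreover have "t - (pi / real n + - pi / (real n)\<^sup>2) = pi / ((real n)\<^sup>2 * real (Suc n))"
    using n by (simp add: t_def field_simps power2_eq_square)
  moreover have "pi / ((real n)\<^sup>2 * real (Suc n)) \<le> pi / real n ^ 3"
    using n by (intro divide_left_mono mult_pos_pos) (simp_all add: power3_eq_cube power2_eq_square algebra_simps)
  moreover have "pi / ((real n)\<^sup>2 * real (Suc n)) \<ge> 0" by simp
  ultimately show ?thesis
    using t3 unfolding t_def[symmetric] add_divide_distrib by linarith
qed

theorem theorem4:
  "\<exists>(\<epsilon> :: nat \<Rightarrow> nat \<Rightarrow> real) (\<alpha> :: nat \<Rightarrow> nat \<Rightarrow> real).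
     (\<forall>N\<ge>1. \<forall>k\<in>{1..N}. \<epsilon> N k > 0) \<and>
     (\<exists>M. \<forall>N\<ge>1. \<forall>k\<in>{1..N}. \<bar>\<alpha> N k\<bar> \<le> M) \<and>
     (\<exists>C. \<forall>N\<ge>1. \<forall>k\<in>{1..N}.
        \<bar>\<epsilon> N k - (pi / real N + \<alpha> N k / (real N)\<^sup>2)\<bar> \<le> C / (real N) ^ 3) \<and>
     \<not> converges_to_identity (\<lambda>N. comp_upto (\<lambda>k. par_map (\<epsilon> N k)) N)"
proof (intro exI conjI)
  let ?e = "\<lambda>N (k::nat). 2 * sin (pi / real (Suc N) / 2)"
  have "0 < pi / real (Suc N) / 2" "pi / real (Suc N) / 2 < pi" for N
    by (simp, simp add: field_simps add_pos_nonneg)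
  then show "\<forall>N\<ge>1. \<forall>k\<in>{1..N}. ?e N k > 0"
    by (simp add: sin_gt_zero)
  show "\<forall>N\<ge>1. \<forall>k\<in>{1..N}. \<bar>(\<lambda>N k. - pi) N k\<bar> \<le> pi"
    by simp
  show "\<forall>N\<ge>1. \<forall>k\<in>{1..N}.
      \<bar>?e N k - (pi / real N + (\<lambda>N k. - pi) N k / (real N)\<^sup>2)\<bar> \<le> (pi ^ 3 + pi) / (real N) ^ 3"
    using two_sin_half_pi_over_Suc by blast
  show "\<not> converges_to_identity (\<lambda>N. comp_upto (\<lambda>k. par_map (?e N k)) N)"
  proof
    let ?F = "\<lambda>N. comp_upto (\<lambda>k. par_map (?e N k)) N"
    let ?w = "\<lambda>N. 1 - 1 / (2 * cos (pi / real (Suc N)))"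
    assume "converges_to_identity ?F"
    then have "uniform_limit {1} (\<lambda>N z. the (?F N (Some z))) (\<lambda>z. z) sequentially"
      unfolding converges_to_identity_def using compact_sing by (elim allE[of _ "{1}"]) simp
    then have "(\<lambda>N. the (?F N (Some 1))) \<longlonglongrightarrow> 1"
      by (rule tendsto_uniform_limitI) simp
    \<comment> \<open>For \<open>N = 1\<close> the image of 1 is infinity, so the closed form is
      used only from 2 on.\<close>
    moreover have "\<forall>\<^sub>F N in sequentially. the (?F N (Some 1)) = of_real (?w N)"
      using eventually_ge_at_top[of 2] by eventually_elim (simp only: comp_upto_pi_over_Suc option.sel)
    ultimately have "(\<lambda>N. complex_of_real (?w N)) \<longlonglongrightarrow> of_real 1"
      unfolding of_real_1 by (rule Lim_transform_eventually)
    then have "?w \<longlonglongrightarrow> 1"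
      by (simp only: tendsto_of_real_iff)
    moreover have "(\<lambda>N. pi / real (Suc N)) \<longlonglongrightarrow> 0"
      by (intro LIMSEQ_Suc lim_const_over_n)
    \<comment> \<open>This limit is 1/2, the value of z / (1 + z) at 1.\<close>
    then have "?w \<longlonglongrightarrow> 1 - 1 / (2 * cos 0)"
      by (intro tendsto_intros) (simp_all del: of_nat_Suc)
    ultimately have "1 = 1 - 1 / (2 * cos (0 :: real))"
      by (rule LIMSEQ_unique)
    then show False
      by simp
  qed
qed

end
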